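(* Let $m\ge 3$. Starting from the canonical coloring of $D_3(m)$, perform successively: (1) swap colors $(0,1)$ on the line $L_0=\{S=0,\ k=0\}$; (2) swap colors $(0,2)$ on the plane $P_0=\{S=0\}$; (3) swap colors $(0,1)$ on $P_0$; (4) swap colors $(0,1)$ on the line $L_1=\{S=1,\ k=0\}$; (5) swap colors $(0,2)$ on the plane $P_1=\{S=1\}$. Each of these five operations is a Kempe swap (its support is a union of cycles of the corresponding Kempe map of the current coloring), and the resulting triple is a coloring of $D_3(m)$.
   Context: $V=(\mathbb Z_m)^3$ with points written $(i,j,k)$; $e_1,e_2,e_3$ are the standard basis vectors; $D_3(m)$ has arcs $v\to v+e_1,v+e_2,v+e_3$ (mod $m$); $S(i,j,k)=i+j+k\pmod m$. A coloring is a triple $(f_0,f_1,f_2)$ of permutations of $V$ with $\{f_0(v),f_1(v),f_2(v)\}=\{v+e_1,v+e_2,v+e_3\}$ for all $v$. The canonical coloring is $f_0(v)=v+e_1$, $f_1(v)=v+e_2$, $f_2(v)=v+e_3$. For a coloring and colors $r\ne s$, the Kempe map is $\tau_{r,s}=f_s^{-1}\circ f_r$; swapping colors $(r,s)$ on $X\subseteq V$ means replacing $f_r$ by $f_s$ and $f_s$ by $f_r$ at every vertex of $X$, leaving all else unchanged; this is a Kempe swap when $X$ is a union of cycles of $\tau_{r,s}$. *)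

theory Defs
  imports "HOL-Combinatorics.Combinatorics"
begin

text \<open>Elements of \<open>(\<int>/m)\<^sup>3\<close> are represented by triples of canonical residues
  \<open>0, \<dots>, m - 1\<close>.\<close>

type_synonym point = "nat \<times> nat \<times> nat"

definition verts :: "nat \<Rightarrow> point set" where
  "verts m = {0..<m} \<times> {0..<m} \<times> {0..<m}"

fun add_mod :: "nat \<Rightarrow> point \<Rightarrow> point \<Rightarrow> point" where
  "add_mod m (i, j, k) (i', j', k') = ((i + i') mod m, (j + j') mod m, (k + k') mod m)"

definition e1 :: point where "e1 = (1, 0, 0)"
definition e2 :: point where "e2 = (0, 1, 0)"
definition e3 :: point where "e3 = (0, 0, 1)"

definition out_nbrs :: "nat \<Rightarrow> point \<Rightarrow> point set" where
  "out_nbrs m v = {add_mod m v e1, add_mod m v e2, add_mod m v e3}"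

fun S :: "nat \<Rightarrow> point \<Rightarrow> nat" where
  "S m (i, j, k) = (i + j + k) mod m"

text \<open>A triple \<open>(f\<^sub>0, f\<^sub>1, f\<^sub>2)\<close> of maps is a function of the color index; only the
  values at the colors 0, 1, 2 matter. With \<open>permutes\<close>, each map is the identity
  outside \<open>verts m\<close>, so that the total inverse \<open>inv\<close> extends the inverse on \<open>verts m\<close>.\<close>

type_synonym color_maps = "nat \<Rightarrow> point \<Rightarrow> point"

definition coloring :: "nat \<Rightarrow> color_maps \<Rightarrow> bool" where
  "coloring m f \<longleftrightarrow>
     (\<forall>r\<in>{0, 1, 2}. f r permutes verts m) \<and>
     (\<forall>v\<in>verts m. {f 0 v, f 1 v, f 2 v} = out_nbrs m v)"

definition canonical :: "nat \<Rightarrow> color_maps" where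
  "canonical m r v =
     (if v \<notin> verts m then v
      else if r = 0 then add_mod m v e1
      else if r = 1 then add_mod m v e2
      else if r = 2 then add_mod m v e3
      else v)"

definition kempe_map :: "color_maps \<Rightarrow> nat \<Rightarrow> nat \<Rightarrow> point \<Rightarrow> point" where
  "kempe_map f r s = inv (f s) \<circ> f r"

definition swap_colors :: "nat \<Rightarrow> nat \<Rightarrow> point set \<Rightarrow> color_maps \<Rightarrow> color_maps" where
  "swap_colors r s X f =
     f(r := (\<lambda>v. if v \<in> X then f s v else f r v),
       s := (\<lambda>v. if v \<in> X then f r v else f s v))"

text \<open>The cycles of a permutation, as vertex sets, are its orbits (fixed points
  included). Being a Kempe swap presupposes that \<open>f\<close> is a coloring.\<close>

definition is_kempe_swap :: "nat \<Rightarrow> color_maps \<Rightarrow> nat \<Rightarrow> nat \<Rightarrow> point set \<Rightarrow> bool" where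
  "is_kempe_swap m f r s X \<longleftrightarrow>
     coloring m f \<and> r \<in> {0, 1, 2} \<and> s \<in> {0, 1, 2} \<and> r \<noteq> s \<and>
     (\<exists>\<C> \<subseteq> orbit (kempe_map f r s) ` verts m. X = \<Union>\<C>)"

definition line :: "nat \<Rightarrow> nat \<Rightarrow> point set" where
  "line m c = {(i, j, k). (i, j, k) \<in> verts m \<and> S m (i, j, k) = c \<and> k = 0}"

definition plane :: "nat \<Rightarrow> nat \<Rightarrow> point set" where
  "plane m c = {v \<in> verts m. S m v = c}"

end

theory Submission imports Defs begin

text \<open>If \<open>f\<^sub>r\<close> and \<open>f\<^sub>s\<close> have the same image of \<open>X\<close>, then \<open>X\<close> is invariant under the
  Kempe map, hence a union of its cycles, and swapping on \<open>X\<close> again gives permutations. Every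
  color class of every coloring maps the level set \<open>S = c\<close> onto the level set \<open>S = c + 1\<close>, so a
  plane always supports a Kempe swap. The steps \<open>+e\<^sub>1\<close> and \<open>+e\<^sub>2\<close> fix the third coordinate, so in
  the canonical coloring both map the line \<open>S = c, k = 0\<close> onto the line \<open>S = c + 1, k = 0\<close>; this
  still applies to \<open>L\<^sub>1\<close> in the fourth step, since the first three only affect \<open>S = 0\<close>.\<close>

lemma finite_verts: "finite (verts m)"
  by (simp add: verts_def)

text \<open>On a finite set surjectivity forces injectivity by counting, so it is enough to compute
  images.\<close>

lemma permutes_imageI:
  assumes "finite V" "\<And>v. v \<notin> V \<Longrightarrow> f v = v" "f ` V = V"
  shows "f permutes V"
proof (rule bij_imp_permutes)
  show "bij_betw f V V"
    using assms eq_card_imp_inj_on[of V f] by (simp add: bij_betw_def)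
qed (use assms in auto)

text \<open>The new map sends \<open>X\<close> onto \<open>g\<close> X\<open>, which is\<close>f
  \<open>X\<close>, and acts as \<open>f\<close> elsewhere, so its total image is still that of
  \<open>f\<close>.\<close>

lemma permutes_swap:
  assumes "finite V" "f permutes V" "g permutes V" "X \<subseteq> V" "f ` X = g ` X"
  shows "(\<lambda>v. if v \<in> X then g v else f v) permutes V"
proof (rule permutes_imageI)
  have "(\<lambda>v. if v \<in> X then g v else f v) ` V = g ` X \<union> f ` (V - X)"
    using assms(4) by auto
  also have "\<dots> = f ` (X \<union> (V - X))"
    by (simp only: image_Un assms(5))
  also have "X \<union> (V - X) = V"
    using assms(4) by blast
  finally show "(\<lambda>v. if v \<in> X then g v else f v) ` V = V"
    using assms(2) by (simp add: permutes_image)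
qed (use assms in \<open>auto simp: permutes_not_in\<close>)

text \<open>At each vertex the three values are merely rearranged, so only the permutation property
  needs the equal images; it is used in both directions, once for each swapped color.\<close>

lemma coloring_swap_colors:
  assumes f: "coloring m f" and rs: "r \<in> {0, 1, 2}" "s \<in> {0, 1, 2}" "r \<noteq> s"
    and X: "X \<subseteq> verts m" "f r ` X = f s ` X"
  shows "coloring m (swap_colors r s X f)"
proof -
  have p: "f t permutes verts m" if "t \<in> {0, 1, 2}" for t
    using f that unfolding coloring_def by blast
  have "swap_colors r s X f t permutes verts m" if "t \<in> {0, 1, 2}" for t
    using p[OF that] permutes_swap[OF finite_verts p[OF rs(1)] p[OF rs(2)] X]
      permutes_swap[OF finite_verts p[OF rs(2)] p[OF rs(1)] X(1) X(2)[symmetric]] rs(3)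
    by (auto simp: swap_colors_def)
  moreover have "{swap_colors r s X f 0 v, swap_colors r s X f 1 v, swap_colors r s X f 2 v}
      = {f 0 v, f 1 v, f 2 v}" for v
    using rs by (auto simp: swap_colors_def)
  ultimately show ?thesis
    using f unfolding coloring_def by simp
qed

lemma is_kempe_swapI:
  assumes f: "coloring m f" and rs: "r \<in> {0, 1, 2}" "s \<in> {0, 1, 2}" "r \<noteq> s"
    and X: "X \<subseteq> verts m" "f r ` X = f s ` X"
  shows "is_kempe_swap m f r s X"
proof -
  define g where "g = kempe_map f r s"
  have p: "f r permutes verts m" "f s permutes verts m"
    using f rs unfolding coloring_def by blast+
  have "g permutes verts m"
    unfolding g_def kempe_map_def by (intro permutes_compose permutes_inv p)
  \<comment> \<open>An orbit is generated from \<open>g x\<close>, not from \<open>x\<close>; the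
    point returns to itself because a permutation of a finite set has finite order.\<close>
  then have self: "x \<in> orbit g x" for x
    by (meson finite_verts permutation_permutes permutation_self_in_orbit)
  have inv: "g x \<in> X" if "x \<in> X" for x
  proof -
    have "f r x \<in> f s ` X"
      using that X(2) by blast
    then obtain y where "y \<in> X" "f r x = f s y"
      by blast
    then show ?thesis
      by (simp add: g_def kempe_map_def permutes_inverses(2)[OF p(2)])
  qed
  have "y \<in> X" if "y \<in> orbit g x" "x \<in> X" for x y
    using that by (induction rule: orbit.induct) (simp_all add: inv)
  \<comment> \<open>The required family of cycles consists of the orbits of the points of
    \<open>X\<close> themselves.\<close>
  then have "X = \<Union> (orbit g ` X)"
    using self by blast
  moreover have "orbit g ` X \<subseteq> orbit g ` verts m"
    using X(1) by blast
  ultimately show ?thesis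
    unfolding is_kempe_swap_def g_def[symmetric] by (intro conjI f rs exI[of _ "orbit g ` X"])
qed

text \<open>Surjectivity on \<open>V\<close> turns a pointwise equivalence into an equality of
  images; a one-way implication would give only an inclusion.\<close>

lemma permutes_image_Collect:
  assumes "f permutes V" "\<And>v. v \<in> V \<Longrightarrow> Q (f v) \<longleftrightarrow> P v"
  shows "f ` {v \<in> V. P v} = {v \<in> V. Q v}"
proof (intro equalityI subsetI)
  fix w assume w: "w \<in> {v \<in> V. Q v}"
  then obtain v where "v \<in> V" "w = f v"
    using permutes_image[OF assms(1)] by blast
  then show "w \<in> f ` {v \<in> V. P v}"
    using w assms(2) by auto
qed (use assms permutes_in_image[OF assms(1)] in auto)

text \<open>Adding \<open>m - 1\<close> undoes the successor modulo \<open>m\<close>. The case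
  \<open>m = 0\<close>, where the subtraction truncates, is separate.\<close>

lemma Suc_mod_inject:
  fixes a b m :: nat
  assumes "Suc a mod m = Suc b mod m"
  shows "a mod m = b mod m"
proof -
  have "(Suc a + (m - 1)) mod m = (Suc b + (m - 1)) mod m"
    using assms by (rule mod_add_cong) simp
  moreover have "Suc c + (m - 1) = c + m" if "m > 0" for c
    using that by simp
  ultimately show ?thesis
    using assms by (cases "m = 0") auto
qed

lemma S_add_mod: "S m (add_mod m v w) = (S m v + S m w) mod m"
proof (cases v; cases w)
  fix a b c a' b' c'
  assume [simp]: "v = (a, b, c)" "w = (a', b', c')"
  have "((a + a') mod m + (b + b') mod m + (c + c') mod m) mod m
      = (a + a' + (b + b') + (c + c')) mod m"
    by (intro mod_add_cong) simp_all
  then show ?thesis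
    by (simp add: mod_add_eq ac_simps del: mod_add_left_eq mod_add_right_eq)
qed

lemma S_out_nbrs: "w \<in> out_nbrs m v \<Longrightarrow> S m w = Suc (S m v) mod m"
  by (auto simp: out_nbrs_def e1_def e2_def e3_def S_add_mod mod_Suc_eq)

text \<open>The successor cancels modulo \<open>m\<close>, and both \<open>S m v\<close> and
  \<open>c\<close> are reduced residues, so congruence becomes equality.\<close>

lemma S_out_nbrs_iff:
  assumes "w \<in> out_nbrs m v" "c < m"
  shows "S m w = Suc c mod m \<longleftrightarrow> S m v = c"
proof -
  have "S m v mod m = S m v"
    by (cases v) simp
  then show ?thesis
    using S_out_nbrs[OF assms(1)] assms(2) Suc_mod_inject[of "S m v" m c] by auto
qed

lemma coloring_image_plane:
  assumes "coloring m f" "r \<in> {0, 1, 2}" "c < m"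
  shows "f r ` plane m c = plane m (Suc c mod m)"
  unfolding plane_def
proof (rule permutes_image_Collect)
  fix v assume "v \<in> verts m"
  then have "f r v \<in> out_nbrs m v"
    using assms(1,2) unfolding coloring_def by blast
  then show "S m (f r v) = Suc c mod m \<longleftrightarrow> S m v = c"
    using assms(3) by (rule S_out_nbrs_iff)
qed (use assms in \<open>auto simp: coloring_def\<close>)

lemma plane_swap:
  assumes "coloring m f" "r \<in> {0, 1, 2}" "s \<in> {0, 1, 2}" "r \<noteq> s" "c < m"
  shows "is_kempe_swap m f r s (plane m c)" "coloring m (swap_colors r s (plane m c) f)"
proof -
  have "plane m c \<subseteq> verts m" "f r ` plane m c = f s ` plane m c"
    using coloring_image_plane[OF assms(1) assms(2) assms(5)]
      coloring_image_plane[OF assms(1) assms(3) assms(5)] by (auto simp: plane_def)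
  with assms(1-4) show "is_kempe_swap m f r s (plane m c)"
    "coloring m (swap_colors r s (plane m c) f)"
    by (blast intro: is_kempe_swapI, blast intro: coloring_swap_colors)
qed

lemma add_mod_permutes:
  assumes "e \<in> {e1, e2, e3}"
  shows "(\<lambda>v. if v \<notin> verts m then v else add_mod m v e) permutes verts m" (is "?g permutes _")
proof -
  have "inj_on ?g (verts m)"
  proof (rule inj_onI)
    fix v w assume "v \<in> verts m" "w \<in> verts m" "?g v = ?g w"
    then show "v = w"
      \<comment> \<open>Only one coordinate moves; there the successors are congruent, and the
        residues below \<open>m\<close> must agree.\<close>
      using assms by (cases v; cases w)
        (auto simp: verts_def e1_def e2_def e3_def dest!: Suc_mod_inject)
  qed
  moreover have "?g ` verts m \<subseteq> verts m"
    using assms by (auto simp: verts_def e1_def e2_def e3_def)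
  ultimately show ?thesis
    by (intro permutes_imageI endo_inj_surj finite_verts) auto
qed

lemma coloring_canonical: "coloring m (canonical m)"
  using add_mod_permutes[of e1 m] add_mod_permutes[of e2 m] add_mod_permutes[of e3 m]
  by (auto simp: coloring_def canonical_def[abs_def] out_nbrs_def cong: if_cong)

text \<open>Puts the line into the shape that \<open>permutes_image_Collect\<close> expects.\<close>

lemma line_eq: "line m c = {v \<in> verts m. S m v = c \<and> snd (snd v) = 0}"
  by (auto simp: line_def)

lemma canonical_image_line:
  assumes "r \<in> {0, 1}" "c < m"
  shows "canonical m r ` line m c = line m (Suc c mod m)"
  unfolding line_eq
proof (rule permutes_image_Collect)
  show "canonical m r permutes verts m"
    using coloring_canonical assms(1) unfolding coloring_def by blast
  fix v assume v: "v \<in> verts m"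
  then have "canonical m r v \<in> out_nbrs m v" "snd (snd (canonical m r v)) = snd (snd v)"
    using assms(1) by (auto simp: canonical_def out_nbrs_def e1_def e2_def verts_def)
  then show "S m (canonical m r v) = Suc c mod m \<and> snd (snd (canonical m r v)) = 0 \<longleftrightarrow>
      S m v = c \<and> snd (snd v) = 0"
    using assms(2) by (simp add: S_out_nbrs_iff)
qed

text \<open>The image of the line depends only on values on it, so agreement with
  \<open>canonical\<close> is asked for there alone and the coloring may differ elsewhere.\<close>

lemma line_swap:
  assumes "coloring m f" "c < m"
    and "\<And>r v. r \<in> {0, 1} \<Longrightarrow> v \<in> line m c \<Longrightarrow> f r v = canonical m r v"
  shows "is_kempe_swap m f 0 1 (line m c)" "coloring m (swap_colors 0 1 (line m c) f)"
proof -
  have "f r ` line m c = line m (Suc c mod m)" if "r \<in> {0, 1}" for r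
    using assms that canonical_image_line[of r c m] by (metis image_cong)
  then have "line m c \<subseteq> verts m" "f 0 ` line m c = f 1 ` line m c"
    by (auto simp: line_eq)
  with assms(1) show "is_kempe_swap m f 0 1 (line m c)"
    "coloring m (swap_colors 0 1 (line m c) f)"
    by (auto intro!: is_kempe_swapI coloring_swap_colors)
qed

theorem theorem3p1:
  fixes m :: nat and F0 F1 F2 F3 F4 F5 :: color_maps
  assumes "m \<ge> 3"
    and "F0 = canonical m"
    and "F1 = swap_colors 0 1 (line m 0) F0"
    and "F2 = swap_colors 0 2 (plane m 0) F1"
    and "F3 = swap_colors 0 1 (plane m 0) F2"
    and "F4 = swap_colors 0 1 (line m 1) F3"
    and "F5 = swap_colors 0 2 (plane m 1) F4"
  shows "is_kempe_swap m F0 0 1 (line m 0) \<and>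
         is_kempe_swap m F1 0 2 (plane m 0) \<and>
         is_kempe_swap m F2 0 1 (plane m 0) \<and>
         is_kempe_swap m F3 0 1 (line m 1) \<and>
         is_kempe_swap m F4 0 2 (plane m 1) \<and>
         coloring m F5"
proof -
  have m: "0 < m" "1 < m"
    using assms(1) by auto
  have c0: "coloring m F0"
    using assms(2) coloring_canonical by simp
  have k0: "is_kempe_swap m F0 0 1 (line m 0)" and c1: "coloring m F1"
    using line_swap[OF c0 m(1)] assms(2,3) by auto
  have k1: "is_kempe_swap m F1 0 2 (plane m 0)" and c2: "coloring m F2"
    using plane_swap[OF c1 _ _ _ m(1), of 0 2] assms(4) by auto
  have k2: "is_kempe_swap m F2 0 1 (plane m 0)" and c3: "coloring m F3"
    using plane_swap[OF c2 _ _ _ m(1), of 0 1] assms(5) by auto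
  have "F3 r v = canonical m r v" if "v \<in> line m 1" for r v
  proof -
    \<comment> \<open>The supports of the first three swaps lie in level 0, while \<open>v\<close>
      has level 1.\<close>
    have "v \<notin> line m 0" "v \<notin> plane m 0"
      using that by (auto simp: line_eq plane_def)
    then show ?thesis
      by (simp add: assms(2-5) swap_colors_def)
  qed
  then have k3: "is_kempe_swap m F3 0 1 (line m 1)" and c4: "coloring m F4"
    using line_swap[OF c3 m(2)] assms(6) by auto
  have "is_kempe_swap m F4 0 2 (plane m 1)" "coloring m F5"
    using plane_swap[OF c4 _ _ _ m(2), of 0 2] assms(7) by auto
  with k0 k1 k2 k3 show ?thesis
    by blast
qed

end
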